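(* Let $D\subset\mathbb{C}$ be an open simply connected domain, $N\ge 1$, and let $B$ be an $(N\times N)$-matrix function on $D$. Consider the systems $$\partial_{\bar z}\Psi + B\,\bar\Psi = 0 \qquad (\mathrm{I}_B)$$ and $$\partial_z\Psi^+ - \bar\Psi^+ B = 0 \qquad (\mathrm{II}_B)$$ for $(N\times N)$-matrix functions $\Psi,\Psi^+$ on $D$. Let $F$ be an arbitrary fixed solution of $(\mathrm{I}_B)$ and $F^+$ an arbitrary fixed solution of $(\mathrm{II}_B)$. For a solution $\Phi$ of $(\mathrm{I}_B)$ and a solution $\Phi^+$ of $(\mathrm{II}_B)$, let $\omega_{\Phi,\Phi^+}$ denote an $(N\times N)$-matrix function on $D$ satisfying $$\partial_{\bar z}\,\omega_{\Phi,\Phi^+} = \Phi^+\,\bar\Phi,\qquad \mathrm{Re}\,\omega_{\Phi,\Phi^+}=0.$$ Suppose that $\det\omega_{F,F^+}\neq 0$ everywhere on $D$, and put $$\tilde B = B + F\,\omega_{F,F^+}^{-1}\,F^+ .$$ Then systems $(\mathrm{I}_B)$ and $(\mathrm{II}_B)$ are mapped to systems of the same type with $B$ replaced by $\tilde B$, in the following sense: for every solution $\Psi$ of $(\mathrm{I}_B)$ and every solution $\Psi^+$ of $(\mathrm{II}_B)$, the functions $$\tilde\Psi = \Psi - F\,\omega_{F,F^+}^{-1}\,\omega_{\Psi,F^+},\qquad \tilde\Psi^+ = \Psi^+ - \omega_{F,\Psi^+}\,\omega_{F,F^+}^{-1}\,F^+$$ satisfy $$\partial_{\bar z}\tilde\Psi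 + \tilde B\,\overline{\tilde\Psi} = 0,\qquad \partial_z\tilde\Psi^+ - \overline{\tilde\Psi^+}\,\tilde B = 0 .$$
   Context: All matrix functions take values in complex $(N\times N)$-matrices; $z=x+iy$ is the coordinate on $D$, $\partial_z=\frac12(\partial_x-i\partial_y)$, $\partial_{\bar z}=\frac12(\partial_x+i\partial_y)$ act entrywise. A bar over a matrix denotes entrywise complex conjugation (no transposition), and $\mathrm{Re}$ is the entrywise real part, so $\mathrm{Re}\,\omega=0$ means that all entries of $\omega$ are purely imaginary. Functions that are differentiated are assumed to be differentiable (in the real sense) and the equations hold pointwise on $D$. The functions $\omega_{\Phi,\Phi^+}$ are determined by $\Phi,\Phi^+$ up to an additive constant purely imaginary matrix; $\omega_{F,F^+}$, $\omega_{\Psi,F^+}$, $\omega_{F,\Psi^+}$ denote any fixed choices of such functions. *)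

theory Defs
  imports "HOL-Analysis.Analysis"
begin

(* With z = x + i y, the partial derivatives of f in x and y are the real Frechet derivative
   of f at z applied to the directions 1 and i. *)

definition deriv_z :: "(complex \<Rightarrow> complex) \<Rightarrow> complex \<Rightarrow> complex" where
  "deriv_z f z = (frechet_derivative f (at z) 1 - \<i> * frechet_derivative f (at z) \<i>) / 2"

definition deriv_zbar :: "(complex \<Rightarrow> complex) \<Rightarrow> complex \<Rightarrow> complex" where
  "deriv_zbar f z = (frechet_derivative f (at z) 1 + \<i> * frechet_derivative f (at z) \<i>) / 2"

definition mderiv_z :: "(complex \<Rightarrow> complex^'n^'m) \<Rightarrow> complex \<Rightarrow> complex^'n^'m" where
  "mderiv_z A z = (\<chi> i j. deriv_z (\<lambda>w. A w $ i $ j) z)"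

definition mderiv_zbar :: "(complex \<Rightarrow> complex^'n^'m) \<Rightarrow> complex \<Rightarrow> complex^'n^'m" where
  "mderiv_zbar A z = (\<chi> i j. deriv_zbar (\<lambda>w. A w $ i $ j) z)"

(* The notion "differentiable" below is real differentiability, complex being taken as a
   real normed space.  All functions are total; only their values on D matter, D being open. *)

definition solves_I ::
  "complex set \<Rightarrow> (complex \<Rightarrow> complex^'n^'n) \<Rightarrow> (complex \<Rightarrow> complex^'n^'n) \<Rightarrow> bool" where
  "solves_I D B \<Psi> \<longleftrightarrow>
     (\<forall>z\<in>D. \<Psi> differentiable (at z) \<and> mderiv_zbar \<Psi> z + B z ** map_matrix cnj (\<Psi> z) = 0)"

definition solves_II ::
  "complex set \<Rightarrow> (complex \<Rightarrow> complex^'n^'n) \<Rightarrow> (complex \<Rightarrow> complex^'n^'n) \<Rightarrow> bool" where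
  "solves_II D B \<Psi>p \<longleftrightarrow>
     (\<forall>z\<in>D. \<Psi>p differentiable (at z) \<and> mderiv_z \<Psi>p z - map_matrix cnj (\<Psi>p z) ** B z = 0)"

(* The potential is unique only up to an additive constant purely imaginary matrix,
   so it is a relation between functions and not a function of the pair. *)

definition is_potential ::
  "complex set \<Rightarrow> (complex \<Rightarrow> complex^'n^'n) \<Rightarrow> (complex \<Rightarrow> complex^'n^'n)
     \<Rightarrow> (complex \<Rightarrow> complex^'n^'n) \<Rightarrow> bool" where
  "is_potential D \<Phi> \<Phi>p \<omega> \<longleftrightarrow>
     (\<forall>z\<in>D. \<omega> differentiable (at z) \<and> mderiv_zbar \<omega> z = \<Phi>p z ** map_matrix cnj (\<Phi> z)
       \<and> map_matrix Re (\<omega> z) = 0)"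

end

theory Submission
  imports Defs
begin

text \<open>
  The transformed equations follow from the product rule, the rule
  \<open>\<partial>W = - W (\<partial>\<omega>) W\<close> for \<open>W = \<omega>\<^sup>-\<^sup>1\<close>, and the fact that potentials and their
  inverses are purely imaginary. For \<open>(I)\<close>, write \<open>\<Omega>\<close> for the potential of \<open>\<Psi>\<close> and \<open>F\<^sup>+\<close>, and a bar
  for entrywise conjugation. Then the zbar-derivative of \<open>\<Psi> - F W \<Omega>\<close> is
  \<open>- B \<Psi>bar + B Fbar W \<Omega> + F (W F\<^sup>+ Fbar W) \<Omega> - F W F\<^sup>+ \<Psi>bar
    = - (B + F W F\<^sup>+) (\<Psi>bar - Fbar W \<Omega>)\<close>.
  The last factor is the conjugate of \<open>\<Psi> - F W \<Omega>\<close>, because the conjugates of \<open>W\<close> and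
  \<open>\<Omega>\<close> are \<open>- W\<close> and \<open>- \<Omega>\<close>, and the two signs cancel.

  For \<open>(II)\<close> the z-derivatives of the potentials are needed. A purely imaginary function is minus its
  own conjugate, so \<open>\<partial>\<^sub>z \<omega>\<close> is minus the conjugate of its zbar-derivative
  (\<open>mderiv_z_imaginary\<close>), that is \<open>- F\<^sup>+bar F\<close>. The same factorisation then works on the other side:
  with \<open>\<Omega>\<close> now the potential of \<open>F\<close> and \<open>\<Psi>\<^sup>+\<close>, the z-derivative of \<open>\<Psi>\<^sup>+ - \<Omega> W F\<^sup>+\<close> is
  \<open>(\<Psi>\<^sup>+bar - \<Omega> W F\<^sup>+bar) (B + F W F\<^sup>+)\<close>.

  The product and inverse rules have the same proof for both Wirtinger operators, so they are proved
  for a one-parameter family containing both (\<open>mwirtinger_mult\<close>,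
  \<open>mwirtinger_matrix_inv\<close>). That \<open>W\<close> is differentiable at all comes from Cramer's rule
  (\<open>differentiable_matrix_inv\<close>).
\<close>

section \<open>Matrix algebra\<close>

lemma matrix_diff_ldistrib: "A ** (B - C) = A ** B - A ** (C :: 'a::ring_1^'p^'n)"
  by (simp add: vec_eq_iff matrix_matrix_mult_def algebra_simps sum_subtractf)

lemma matrix_diff_rdistrib: "(A - B) ** C = A ** C - B ** (C :: 'a::ring_1^'p^'n)"
  by (simp add: vec_eq_iff matrix_matrix_mult_def algebra_simps sum_subtractf)

lemma matrix_add_rdistrib: "(A + B) ** C = A ** C + B ** (C :: 'a::semiring_1^'p^'n)"
  by (simp add: vec_eq_iff matrix_matrix_mult_def algebra_simps sum.distrib)

lemma matrix_minus_left: "(- A) ** B = - (A ** (B :: 'a::ring_1^'p^'n))"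
  by (simp add: vec_eq_iff matrix_matrix_mult_def sum_negf)

lemma matrix_minus_right: "A ** (- B) = - (A ** (B :: 'a::ring_1^'p^'n))"
  by (simp add: vec_eq_iff matrix_matrix_mult_def sum_negf)

lemmas matrix_ring_simps =
  matrix_add_ldistrib matrix_add_rdistrib matrix_diff_ldistrib matrix_diff_rdistrib
  matrix_minus_left matrix_minus_right matrix_mul_assoc

lemma map_matrix_cnj_mult: "map_matrix cnj (A ** B) = map_matrix cnj A ** map_matrix cnj B"
  by (simp add: vec_eq_iff matrix_matrix_mult_def)

lemma map_matrix_cnj_diff: "map_matrix cnj (A - B) = map_matrix cnj A - map_matrix cnj B"
  by (simp add: vec_eq_iff)

lemma map_matrix_cnj_cnj: "map_matrix cnj (map_matrix cnj A) = A"
  by (simp add: vec_eq_iff)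

lemma map_matrix_cnj_imaginary:
  assumes "map_matrix Re A = 0"
  shows "map_matrix cnj A = - A"
  using assms by (simp add: vec_eq_iff complex_eq_iff)

lemma matrix_inv_eqs:
  fixes A :: "'a::field^'n^'n"
  assumes "det A \<noteq> 0"
  shows "A ** matrix_inv A = mat 1" "matrix_inv A ** A = mat 1"
proof -
  have "\<exists>A'. A ** A' = mat 1 \<and> A' ** A = mat 1"
    using assms by (simp add: invertible_det_nz [symmetric] invertible_def)
  then have "A ** matrix_inv A = mat 1 \<and> matrix_inv A ** A = mat 1"
    unfolding matrix_inv_def by (rule someI_ex)
  then show "A ** matrix_inv A = mat 1" "matrix_inv A ** A = mat 1" by auto
qed

text \<open>Conjugation is multiplicative, so the conjugate of the inverse is the inverse of the conjugate,
  which is the inverse of \<open>- A\<close>.\<close>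

lemma map_matrix_cnj_inv_imaginary:
  fixes A :: "complex^'n^'n"
  assumes "det A \<noteq> 0" and "map_matrix Re A = 0"
  shows "map_matrix cnj (matrix_inv A) = - matrix_inv A"
proof -
  let ?W = "matrix_inv A"
  have one: "map_matrix cnj (mat 1) = (mat 1 :: complex^'n^'n)"
    by (simp add: vec_eq_iff mat_def)
  have "map_matrix cnj ?W ** (- A) = mat 1"
    using map_matrix_cnj_mult [of ?W A] assms
    by (simp add: matrix_inv_eqs one map_matrix_cnj_imaginary)
  then have "- (map_matrix cnj ?W ** A) ** ?W = ?W"
    by (simp add: matrix_minus_right)
  then have "- (map_matrix cnj ?W) = ?W"
    using assms by (simp add: matrix_minus_left matrix_mul_assoc [symmetric] matrix_inv_eqs)
  then show ?thesis by (metis minus_minus)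
qed

text \<open>Column \<open>l\<close> of the inverse solves the linear system with the \<open>l\<close>-th unit vector on the
  right. The formula exhibits each entry of the inverse as a rational function of the entries of
  \<open>A\<close>, which is how differentiability is transported to the inverse.\<close>

lemma matrix_inv_cramer:
  fixes A :: "'a::field^'n^'n"
  assumes "det A \<noteq> 0"
  shows "matrix_inv A $ k $ l = det (\<chi> i j. if j = k then mat 1 $ i $ l else A $ i $ j) / det A"
proof -
  have "A *v column l (matrix_inv A) = column l (A ** matrix_inv A)"
    by (simp add: vec_eq_iff column_def matrix_vector_mult_def matrix_matrix_mult_def)
  then have "A *v column l (matrix_inv A) = column l (mat 1)"
    using assms by (simp add: matrix_inv_eqs)
  then have "column l (matrix_inv A)
      = (\<chi> k. det (\<chi> i j. if j = k then column l (mat 1) $ i else A $ i $ j) / det A)"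
    using cramer [OF assms] by blast
  then have "column l (matrix_inv A) $ k
      = (\<chi> k. det (\<chi> i j. if j = k then column l (mat 1) $ i else A $ i $ j) / det A) $ k"
    by simp
  then show ?thesis by (simp add: column_def cong: if_cong)
qed

section \<open>Real differentiability of matrix functions\<close>

text \<open>The Wirtinger operators act on entries, whereas solutions are differentiable as matrix-valued
  maps; this equivalence moves between the two.\<close>

lemma differentiable_matrix_iff:
  fixes A :: "complex \<Rightarrow> complex^'n^'m"
  shows "A differentiable (at z) \<longleftrightarrow> (\<forall>i j. (\<lambda>w. A w $ i $ j) differentiable (at z))"
proof
  assume "A differentiable (at z)"
  then obtain A' where "(A has_derivative A') (at z)"
    by (auto simp: differentiable_def)
  then have "((\<lambda>w. A w $ i $ j) has_derivative (\<lambda>h. A' h $ i $ j)) (at z)" for i j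
    by (intro bounded_linear.has_derivative [OF bounded_linear_vec_nth])
  then show "\<forall>i j. (\<lambda>w. A w $ i $ j) differentiable (at z)"
    unfolding differentiable_def by blast
next
  assume entries: "\<forall>i j. (\<lambda>w. A w $ i $ j) differentiable (at z)"
  have "(\<lambda>w. A w $ i $ j \<bullet> b) differentiable (at z)" for i j b
  proof -
    obtain f' where "((\<lambda>w. A w $ i $ j) has_derivative f') (at z)"
      using entries by (auto simp: differentiable_def)
    then have "((\<lambda>w. A w $ i $ j \<bullet> b) has_derivative (\<lambda>h. f' h \<bullet> b)) (at z)"
      by (rule has_derivative_inner_left)
    then show ?thesis by (auto simp: differentiable_def)
  qed
  then show "A differentiable (at z)"
    by (subst differentiable_componentwise_within) (auto simp: Basis_vec_def inner_axis)
qed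

lemma differentiable_prod:
  fixes f :: "'i \<Rightarrow> 'a::real_normed_vector \<Rightarrow> 'b::real_normed_field"
  assumes "\<And>i. i \<in> I \<Longrightarrow> f i differentiable (at x)"
  shows "(\<lambda>x. \<Prod>i\<in>I. f i x) differentiable (at x)"
  using assms
  by (induction I rule: infinite_finite_induct) auto

lemma differentiable_det:
  fixes A :: "complex \<Rightarrow> complex^'n^'n"
  assumes "\<And>i j. (\<lambda>w. A w $ i $ j) differentiable (at z)"
  shows "(\<lambda>w. det (A w)) differentiable (at z)"
  unfolding det_def using assms
  by (intro differentiable_sum ballI differentiable_mult differentiable_const differentiable_prod)
    (simp_all add: finite_permutations)

lemma differentiable_matrix_mult:
  fixes A :: "complex \<Rightarrow> complex^'k^'m" and B :: "complex \<Rightarrow> complex^'n^'k"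
  assumes "A differentiable (at z)" "B differentiable (at z)"
  shows "(\<lambda>w. A w ** B w) differentiable (at z)"
  using assms by (simp add: differentiable_matrix_iff matrix_matrix_mult_def)

text \<open>The inverse is given by Cramer's quotient only where the determinant does not vanish, hence the
  open set \<open>D\<close>: agreement on a neighbourhood of \<open>z\<close> is what differentiability at \<open>z\<close> needs.\<close>

lemma differentiable_matrix_inv:
  fixes A :: "complex \<Rightarrow> complex^'n^'n"
  assumes "open D" "z \<in> D" "A differentiable (at z)" and nz: "\<forall>w\<in>D. det (A w) \<noteq> 0"
  shows "(\<lambda>w. matrix_inv (A w)) differentiable (at z)"
proof -
  have A: "(\<lambda>w. A w $ i $ j) differentiable (at z)" for i j
    using assms by (simp add: differentiable_matrix_iff)
  have "(\<lambda>w. matrix_inv (A w) $ k $ l) differentiable (at z)" for k l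
  proof -
    \<comment> \<open>Cramer's numerator: \<open>A\<close> with column \<open>k\<close> replaced by the \<open>l\<close>-th unit vector.\<close>
    let ?N = "\<lambda>w. \<chi> i j. if j = k then mat 1 $ i $ l else A w $ i $ j"
    have "(\<lambda>w. ?N w $ i $ j) differentiable (at z)" for i j
      using A by (cases "j = k") auto
    then have "(\<lambda>w. det (?N w) / det (A w)) differentiable (at z)"
      using assms A by (intro differentiable_divide differentiable_det) auto
    then obtain f' where f': "((\<lambda>w. det (?N w) / det (A w)) has_derivative f') (at z)"
      by (auto simp: differentiable_def)
    have "((\<lambda>w. matrix_inv (A w) $ k $ l) has_derivative f') (at z)"
      by (rule has_derivative_transform_within_open [OF f' assms(1,2)])
        (simp add: matrix_inv_cramer nz)
    then show ?thesis by (auto simp: differentiable_def)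
  qed
  then show ?thesis by (simp add: differentiable_matrix_iff)
qed

section \<open>Wirtinger operators as derivations\<close>

text \<open>The operators \<open>(\<partial>\<^sub>x + c \<partial>\<^sub>y) / 2\<close>: \<open>c = \<i>\<close> gives the zbar-derivative and
  \<open>c = - \<i>\<close> the z-derivative. The rules of calculus below hold for every constant \<open>c\<close>.\<close>

definition wirtinger :: "complex \<Rightarrow> (complex \<Rightarrow> complex) \<Rightarrow> complex \<Rightarrow> complex" where
  "wirtinger c f z = (frechet_derivative f (at z) 1 + c * frechet_derivative f (at z) \<i>) / 2"

definition mwirtinger :: "complex \<Rightarrow> (complex \<Rightarrow> complex^'n^'m) \<Rightarrow> complex \<Rightarrow> complex^'n^'m" where
  "mwirtinger c A z = (\<chi> i j. wirtinger c (\<lambda>w. A w $ i $ j) z)"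

lemma mderiv_z_conv_mwirtinger: "mderiv_z A z = mwirtinger (- \<i>) A z"
  by (simp add: mderiv_z_def mwirtinger_def deriv_z_def wirtinger_def)

lemma mderiv_zbar_conv_mwirtinger: "mderiv_zbar A z = mwirtinger \<i> A z"
  by (simp add: mderiv_zbar_def mwirtinger_def deriv_zbar_def wirtinger_def)

lemma wirtinger_eq:
  assumes "(f has_derivative f') (at z)"
  shows "wirtinger c f z = (f' 1 + c * f' \<i>) / 2"
  using frechet_derivative_at [OF assms] by (simp add: wirtinger_def)

lemma wirtinger_mult:
  assumes "f differentiable (at z)" "g differentiable (at z)"
  shows "wirtinger c (\<lambda>w. f w * g w) z = wirtinger c f z * g z + f z * wirtinger c g z"
proof -
  obtain f' g' where d: "(f has_derivative f') (at z)" "(g has_derivative g') (at z)"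
    using assms by (auto simp: differentiable_def)
  show ?thesis
    by (simp add: wirtinger_eq [OF d(1)] wirtinger_eq [OF d(2)]
        wirtinger_eq [OF has_derivative_mult [OF d]] field_simps)
qed

lemma wirtinger_sum:
  assumes "\<And>i. i \<in> I \<Longrightarrow> f i differentiable (at z)"
  shows "wirtinger c (\<lambda>w. \<Sum>i\<in>I. f i w) z = (\<Sum>i\<in>I. wirtinger c (f i) z)"
proof -
  obtain f' where d: "\<And>i. i \<in> I \<Longrightarrow> (f i has_derivative f' i) (at z)"
    using assms unfolding differentiable_def by metis
  have "wirtinger c (\<lambda>w. \<Sum>i\<in>I. f i w) z = (\<Sum>i\<in>I. (f' i 1 + c * f' i \<i>) / 2)"
    by (simp add: wirtinger_eq [OF has_derivative_sum [OF d]]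
        sum.distrib sum_distrib_left sum_divide_distrib add_divide_distrib)
  also have "\<dots> = (\<Sum>i\<in>I. wirtinger c (f i) z)"
    by (intro sum.cong refl) (simp add: wirtinger_eq [OF d])
  finally show ?thesis .
qed

text \<open>The operator is a derivation on scalar functions, and each entry of a matrix product is a sum of
  products of entries, so only the order of the matrix factors has to be respected.\<close>

lemma mwirtinger_mult:
  fixes A :: "complex \<Rightarrow> complex^'k^'m" and B :: "complex \<Rightarrow> complex^'n^'k"
  assumes "A differentiable (at z)" "B differentiable (at z)"
  shows "mwirtinger c (\<lambda>w. A w ** B w) z = mwirtinger c A z ** B z + A z ** mwirtinger c B z"
  using assms
  by (simp add: vec_eq_iff mwirtinger_def matrix_matrix_mult_def differentiable_matrix_iff
      wirtinger_sum wirtinger_mult sum.distrib)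

lemma mwirtinger_diff:
  fixes A B :: "complex \<Rightarrow> complex^'n^'m"
  assumes "A differentiable (at z)" "B differentiable (at z)"
  shows "mwirtinger c (\<lambda>w. A w - B w) z = mwirtinger c A z - mwirtinger c B z"
proof -
  have "wirtinger c (\<lambda>w. A w $ i $ j - B w $ i $ j) z
      = wirtinger c (\<lambda>w. A w $ i $ j) z - wirtinger c (\<lambda>w. B w $ i $ j) z" for i j
  proof -
    obtain f' g' where d: "((\<lambda>w. A w $ i $ j) has_derivative f') (at z)"
        "((\<lambda>w. B w $ i $ j) has_derivative g') (at z)"
      using assms unfolding differentiable_matrix_iff by (meson differentiable_def)
    show ?thesis
      by (simp add: wirtinger_eq [OF d(1)] wirtinger_eq [OF d(2)]
          wirtinger_eq [OF has_derivative_diff [OF d]] field_simps)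
  qed
  then show ?thesis by (simp add: vec_eq_iff mwirtinger_def)
qed

text \<open>Apply the product rule to \<open>A A\<^sup>-\<^sup>1\<close>, which is constant near \<open>z\<close>, and solve for the
  derivative of the inverse.\<close>

lemma mwirtinger_matrix_inv:
  fixes A :: "complex \<Rightarrow> complex^'n^'n"
  assumes D: "open D" "z \<in> D" and A: "A differentiable (at z)"
    and nz: "\<forall>w\<in>D. det (A w) \<noteq> 0"
  shows "mwirtinger c (\<lambda>w. matrix_inv (A w)) z
    = - (matrix_inv (A z) ** mwirtinger c A z ** matrix_inv (A z))"
proof -
  let ?W = "\<lambda>w. matrix_inv (A w)"
  have W: "?W differentiable (at z)"
    using assms by (rule differentiable_matrix_inv)
  have inv: "A z ** ?W z = mat 1" "?W z ** A z = mat 1"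
    using nz D by (auto simp: matrix_inv_eqs)
  have "wirtinger c (\<lambda>w. (A w ** ?W w) $ i $ j) z = 0" for i j
  proof -
    have "((\<lambda>w. (A w ** ?W w) $ i $ j) has_derivative (\<lambda>h. 0)) (at z)"
      by (rule has_derivative_transform_within_open
          [OF has_derivative_const [of "mat 1 $ i $ j"] D])
        (simp add: matrix_inv_eqs nz)
    then show ?thesis by (simp add: wirtinger_eq)
  qed
  then have "mwirtinger c (\<lambda>w. A w ** ?W w) z = 0"
    by (simp add: vec_eq_iff mwirtinger_def)
  then have "mwirtinger c A z ** ?W z + A z ** mwirtinger c ?W z = 0"
    by (simp add: mwirtinger_mult A W)
  then have "?W z ** (A z ** mwirtinger c ?W z) = ?W z ** (- (mwirtinger c A z ** ?W z))"
    by (metis add_eq_0_iff)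
  then show ?thesis
    by (simp add: inv matrix_mul_assoc matrix_minus_right)
qed

text \<open>The potentials are given by their zbar-derivative only. Since conjugation exchanges the two
  Wirtinger operators and an imaginary function is minus its conjugate, their z-derivative is
  determined as well. Imaginarity must hold near \<open>z\<close>, not only at \<open>z\<close>.\<close>

lemma mderiv_z_imaginary:
  fixes A :: "complex \<Rightarrow> complex^'n^'m"
  assumes D: "open D" "z \<in> D" and A: "A differentiable (at z)"
    and im: "\<forall>w\<in>D. map_matrix Re (A w) = 0"
  shows "mderiv_z A z = - map_matrix cnj (mderiv_zbar A z)"
proof -
  have "wirtinger (- \<i>) (\<lambda>w. A w $ i $ j) z = - cnj (wirtinger \<i> (\<lambda>w. A w $ i $ j) z)" for i j
  proof -
    obtain f' where d: "((\<lambda>w. A w $ i $ j) has_derivative f') (at z)"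
      using A unfolding differentiable_matrix_iff by (meson differentiable_def)
    have "((\<lambda>w. - cnj (A w $ i $ j)) has_derivative (\<lambda>h. - cnj (f' h))) (at z)"
      by (intro has_derivative_minus has_derivative_cnj d)
    moreover have "- cnj (A w $ i $ j) = A w $ i $ j" if "w \<in> D" for w
      using im that by (simp add: vec_eq_iff complex_eq_iff)
    ultimately have "((\<lambda>w. A w $ i $ j) has_derivative (\<lambda>h. - cnj (f' h))) (at z)"
      by (rule has_derivative_transform_within_open [OF _ D])
    then have f': "f' = (\<lambda>h. - cnj (f' h))"
      by (rule has_derivative_unique [OF d])
    have "cnj (f' h) = - f' h" for h
      using fun_cong [OF f', of h] by (metis minus_minus)
    then show ?thesis by (simp add: wirtinger_eq [OF d] field_simps)
  qed
  then show ?thesis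
    by (simp add: vec_eq_iff mderiv_z_conv_mwirtinger mderiv_zbar_conv_mwirtinger mwirtinger_def)
qed

section \<open>The Moutard transform\<close>

text \<open>Differentiating \<open>F W \<Omega>\<close> produces the term \<open>F W F\<^sup>+\<close> twice, once from the inverse and once from
  \<open>\<Omega>\<close>; together these form the correction to the coefficient \<open>B\<close>. The two imaginary factors
  \<open>W\<close> and \<open>\<Omega>\<close> make their product invariant under conjugation.\<close>

lemma moutard_solves_I:
  fixes B F Fp \<omega> \<Psi> \<Omega> :: "complex \<Rightarrow> complex^'n^'n"
  assumes D: "open D" and F: "solves_I D B F" and \<omega>: "is_potential D F Fp \<omega>"
    and nz: "\<forall>z\<in>D. det (\<omega> z) \<noteq> 0"
    and \<Psi>: "solves_I D B \<Psi>" and \<Omega>: "is_potential D \<Psi> Fp \<Omega>"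
  shows "solves_I D (\<lambda>z. B z + F z ** matrix_inv (\<omega> z) ** Fp z)
    (\<lambda>z. \<Psi> z - F z ** matrix_inv (\<omega> z) ** \<Omega> z)"
  unfolding solves_I_def
proof (intro ballI conjI)
  fix z assume z: "z \<in> D"
  let ?W = "\<lambda>w. matrix_inv (\<omega> w)" and ?c = "map_matrix cnj"
  have diff: "F differentiable (at z)" "\<Psi> differentiable (at z)" "\<Omega> differentiable (at z)"
      "\<omega> differentiable (at z)"
    using F \<Psi> \<Omega> \<omega> z by (auto simp: solves_I_def is_potential_def)
  have W: "?W differentiable (at z)"
    using D z diff(4) nz by (rule differentiable_matrix_inv)
  note FW = differentiable_matrix_mult [OF diff(1) W]
  note FWO = differentiable_matrix_mult [OF FW diff(3)]
  show "(\<lambda>z. \<Psi> z - F z ** ?W z ** \<Omega> z) differentiable (at z)"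
    by (intro differentiable_diff diff FWO)
  have eqs: "mwirtinger \<i> F z = - (B z ** ?c (F z))" "mwirtinger \<i> \<Psi> z = - (B z ** ?c (\<Psi> z))"
      "mwirtinger \<i> \<omega> z = Fp z ** ?c (F z)" "mwirtinger \<i> \<Omega> z = Fp z ** ?c (\<Psi> z)"
    using F \<Psi> \<omega> \<Omega> z
    by (auto simp: solves_I_def is_potential_def mderiv_zbar_conv_mwirtinger add_eq_0_iff2)
  have "map_matrix Re (\<omega> z) = 0" "map_matrix Re (\<Omega> z) = 0"
    using \<omega> \<Omega> z by (auto simp: is_potential_def)
  then have conj: "?c (?W z) = - ?W z" "?c (\<Omega> z) = - \<Omega> z"
    using nz z by (auto simp: map_matrix_cnj_inv_imaginary map_matrix_cnj_imaginary)
  show "mderiv_zbar (\<lambda>z. \<Psi> z - F z ** ?W z ** \<Omega> z) z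
      + (B z + F z ** ?W z ** Fp z) ** ?c (\<Psi> z - F z ** ?W z ** \<Omega> z) = 0"
    by (simp add: mderiv_zbar_conv_mwirtinger mwirtinger_diff mwirtinger_mult
        mwirtinger_matrix_inv [OF D z diff(4) nz] diff W FW FWO eqs conj
        map_matrix_cnj_diff map_matrix_cnj_mult matrix_ring_simps)
qed

text \<open>The mirror image of the previous argument, with all products in the opposite order. The potentials
  enter through their z-derivatives, obtained from imaginarity.\<close>

lemma moutard_solves_II:
  fixes B F Fp \<omega> \<Psi>p \<Omega> :: "complex \<Rightarrow> complex^'n^'n"
  assumes D: "open D" and Fp: "solves_II D B Fp" and \<omega>: "is_potential D F Fp \<omega>"
    and nz: "\<forall>z\<in>D. det (\<omega> z) \<noteq> 0"
    and \<Psi>p: "solves_II D B \<Psi>p" and \<Omega>: "is_potential D F \<Psi>p \<Omega>"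
  shows "solves_II D (\<lambda>z. B z + F z ** matrix_inv (\<omega> z) ** Fp z)
    (\<lambda>z. \<Psi>p z - \<Omega> z ** matrix_inv (\<omega> z) ** Fp z)"
  unfolding solves_II_def
proof (intro ballI conjI)
  fix z assume z: "z \<in> D"
  let ?W = "\<lambda>w. matrix_inv (\<omega> w)" and ?c = "map_matrix cnj"
  have diff: "Fp differentiable (at z)" "\<Psi>p differentiable (at z)" "\<Omega> differentiable (at z)"
      "\<omega> differentiable (at z)"
    using Fp \<Psi>p \<Omega> \<omega> z by (auto simp: solves_II_def is_potential_def)
  have W: "?W differentiable (at z)"
    using D z diff(4) nz by (rule differentiable_matrix_inv)
  note OW = differentiable_matrix_mult [OF diff(3) W]
  note OWF = differentiable_matrix_mult [OF OW diff(1)]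
  show "(\<lambda>z. \<Psi>p z - \<Omega> z ** ?W z ** Fp z) differentiable (at z)"
    by (intro differentiable_diff diff OWF)
  have im: "\<forall>w\<in>D. map_matrix Re (\<omega> w) = 0" "\<forall>w\<in>D. map_matrix Re (\<Omega> w) = 0"
    using \<omega> \<Omega> by (auto simp: is_potential_def)
  have eqs: "mwirtinger (- \<i>) Fp z = ?c (Fp z) ** B z"
      "mwirtinger (- \<i>) \<Psi>p z = ?c (\<Psi>p z) ** B z"
    using Fp \<Psi>p z by (auto simp: solves_II_def mderiv_z_conv_mwirtinger)
  have pot: "mwirtinger (- \<i>) \<omega> z = - (?c (Fp z) ** F z)"
      "mwirtinger (- \<i>) \<Omega> z = - (?c (\<Psi>p z) ** F z)"
    using mderiv_z_imaginary [OF D z diff(4) im(1)] mderiv_z_imaginary [OF D z diff(3) im(2)] \<omega> \<Omega> z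
    by (auto simp: is_potential_def mderiv_z_conv_mwirtinger map_matrix_cnj_mult map_matrix_cnj_cnj)
  have conj: "?c (?W z) = - ?W z" "?c (\<Omega> z) = - \<Omega> z"
    using nz z im by (auto simp: map_matrix_cnj_inv_imaginary map_matrix_cnj_imaginary)
  show "mderiv_z (\<lambda>z. \<Psi>p z - \<Omega> z ** ?W z ** Fp z) z
      - ?c (\<Psi>p z - \<Omega> z ** ?W z ** Fp z) ** (B z + F z ** ?W z ** Fp z) = 0"
    by (simp add: mderiv_z_conv_mwirtinger mwirtinger_diff mwirtinger_mult
        mwirtinger_matrix_inv [OF D z diff(4) nz] diff W OW OWF eqs pot conj
        map_matrix_cnj_diff map_matrix_cnj_mult matrix_ring_simps)
qed

theorem theorem1:
  fixes D :: "complex set"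
    and B F Fp \<omega>FF Bt :: "complex \<Rightarrow> complex^'n^'n"
  assumes "open D" and "connected D" and "simply_connected D" and "D \<noteq> {}"
    and "solves_I D B F"
    and "solves_II D B Fp"
    and "is_potential D F Fp \<omega>FF"
    and "\<forall>z\<in>D. det (\<omega>FF z) \<noteq> 0"
    and "Bt = (\<lambda>z. B z + F z ** matrix_inv (\<omega>FF z) ** Fp z)"
  shows "\<forall>\<Psi> \<Psi>p \<omega>\<Psi>F \<omega>F\<Psi> :: complex \<Rightarrow> complex^'n^'n.
      solves_I D B \<Psi> \<and> solves_II D B \<Psi>p \<and>
      is_potential D \<Psi> Fp \<omega>\<Psi>F \<and> is_potential D F \<Psi>p \<omega>F\<Psi> \<longrightarrow>
        solves_I D Bt (\<lambda>z. \<Psi> z - F z ** matrix_inv (\<omega>FF z) ** \<omega>\<Psi>F z) \<and>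
        solves_II D Bt (\<lambda>z. \<Psi>p z - \<omega>F\<Psi> z ** matrix_inv (\<omega>FF z) ** Fp z)"
  using assms by (auto intro: moutard_solves_I moutard_solves_II)

end
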